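(* Let $E$ and $F$ be Banach spaces and let $P\in\mathcal P(E,F)$ be a continuous polynomial from $E$ into $F$. Then $P$ takes weakly unconditionally Cauchy series into weakly unconditionally Cauchy series, and unconditionally converging series into unconditionally converging series. That is, if $\sum_{i=1}^\infty x_i$ is a weakly unconditionally Cauchy (respectively, unconditionally converging) series in $E$, then $\sum_{i=1}^\infty P(x_i)$ is a weakly unconditionally Cauchy (respectively, unconditionally converging) series in $F$.
   Context: $E$ and $F$ are real or complex Banach spaces (over the same scalar field, $\mathbf R$ or $\mathbf C$), and $E^*$ denotes the dual space of $E$. $\mathcal P(E,F)$ denotes the space of all continuous polynomials from $E$ into $F$; any $P\in\mathcal P(E,F)$ can be decomposed as a finite sum $P=\sum_{k=0}^n P_k$, where each $P_k$ is a continuous $k$-homogeneous polynomial from $E$ into $F$, i.e. $P_k(x)=\hat P_k(x,\dots,x)$ for a continuous symmetric $k$-linear map $\hat P_k:E^k\to F$ (with $P_0$ constant). A series $\sum_{i=1}^\infty x_i$ in a Banach space $E$ is weakly unconditionally Cauchy if $\sum_{i=1}^\infty |f(x_i)|<\infty$ for every $f\in E^*$. It is unconditionally converging if every subseries is norm convergent. The same definitions apply in $F$.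
   Formalization: The formal theorem additionally assumes P(0)=0 (no constant term); without it the claim fails: for P constant equal to c≠0 and x_i=0, the series of x_i converges unconditionally while the series of P(x_i)=c is not even weakly unconditionally Cauchy. *)

theory Defs
  imports "HOL-Analysis.Analysis"
begin

text \<open>
  The scalar field is a type of sort \<open>{real_normed_field, banach}\<close>. By the Gelfand-Mazur theorem such a
  field is \<open>\<real>\<close> or \<open>\<complex>\<close>, and the types \<^typ>\<open>real\<close> and \<^typ>\<open>complex\<close> are both instances. Class \<^class>\<open>banach\<close> only
  provides the underlying real Banach space, so the scalar multiplication is an explicit parameter
  that has to extend \<^const>\<open>scaleR\<close> and be compatible with the norm. For \<^typ>\<open>real\<close> scalars it equals
  \<^const>\<open>scaleR\<close>.
\<close>

locale banach_space_over = vector_space smul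
  for smul :: "'k::{real_normed_field, banach} \<Rightarrow> 'a::banach \<Rightarrow> 'a" +
  assumes smul_of_real: "smul (of_real r) x = r *\<^sub>R x"
    and norm_smul: "norm (smul c x) = norm c * norm x"

definition dual_space ::
  "('k::{real_normed_field, banach} \<Rightarrow> 'a::banach \<Rightarrow> 'a) \<Rightarrow> ('a \<Rightarrow> 'k) set" where
  "dual_space smul = {f. Vector_Spaces.linear smul (*) f \<and> continuous_on UNIV f}"

text \<open>
  \<open>E\<^sup>k\<close> is the set \<open>{..<k} \<rightarrow>\<^sub>E UNIV\<close> with the product topology. For \<open>k = 0\<close> it has exactly one
  element, so the 0-homogeneous polynomials are the constants.
\<close>

definition continuous_symmetric_multilinear ::
  "('k::{real_normed_field, banach} \<Rightarrow> 'a::banach \<Rightarrow> 'a) \<Rightarrow> ('k \<Rightarrow> 'b::banach \<Rightarrow> 'b) \<Rightarrow> nat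
    \<Rightarrow> ((nat \<Rightarrow> 'a) \<Rightarrow> 'b) \<Rightarrow> bool" where
  "continuous_symmetric_multilinear smulE smulF k A \<longleftrightarrow>
     (\<forall>x \<in> {..<k} \<rightarrow>\<^sub>E UNIV. \<forall>i<k. Vector_Spaces.linear smulE smulF (\<lambda>u. A (x(i := u)))) \<and>
     (\<forall>x \<in> {..<k} \<rightarrow>\<^sub>E UNIV. \<forall>\<pi>. \<pi> permutes {..<k} \<longrightarrow> A (x \<circ> \<pi>) = A x) \<and>
     continuous_map (product_topology (\<lambda>_. euclidean) {..<k}) euclidean A"

definition continuous_homogeneous_polynomial ::
  "('k::{real_normed_field, banach} \<Rightarrow> 'a::banach \<Rightarrow> 'a) \<Rightarrow> ('k \<Rightarrow> 'b::banach \<Rightarrow> 'b) \<Rightarrow> nat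
    \<Rightarrow> ('a \<Rightarrow> 'b) \<Rightarrow> bool" where
  "continuous_homogeneous_polynomial smulE smulF k P \<longleftrightarrow>
     (\<exists>A. continuous_symmetric_multilinear smulE smulF k A \<and> (\<forall>x. P x = A (\<lambda>i\<in>{..<k}. x)))"

definition continuous_polynomial ::
  "('k::{real_normed_field, banach} \<Rightarrow> 'a::banach \<Rightarrow> 'a) \<Rightarrow> ('k \<Rightarrow> 'b::banach \<Rightarrow> 'b)
    \<Rightarrow> ('a \<Rightarrow> 'b) \<Rightarrow> bool" where
  "continuous_polynomial smulE smulF P \<longleftrightarrow>
     (\<exists>n Q. (\<forall>k\<le>n. continuous_homogeneous_polynomial smulE smulF k (Q k)) \<and>
            (\<forall>x. P x = (\<Sum>k\<le>n. Q k x)))"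

definition weakly_unconditionally_Cauchy ::
  "('k::{real_normed_field, banach} \<Rightarrow> 'a::banach \<Rightarrow> 'a) \<Rightarrow> (nat \<Rightarrow> 'a) \<Rightarrow> bool" where
  "weakly_unconditionally_Cauchy smul x \<longleftrightarrow>
     (\<forall>f \<in> dual_space smul. summable (\<lambda>i. norm (f (x i))))"

definition unconditionally_converging :: "(nat \<Rightarrow> 'a::banach) \<Rightarrow> bool" where
  "unconditionally_converging x \<longleftrightarrow> (\<forall>r. strict_mono r \<longrightarrow> summable (\<lambda>j. x (r j)))"

end

theory Submission
  imports Defs
begin

text \<open>
  Both claims reduce to homogeneous polynomials of positive degree, because \<open>P 0 = 0\<close> kills the
  constant term and both kinds of series are closed under finite sums. So let
  \<open>Q x = B (x, \<dots>, x)\<close> with \<open>B\<close> bounded and \<open>k\<close>-linear, \<open>k \<ge> 1\<close>.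

  The heart is an estimate for a sum along the diagonal,
  \<open>\<parallel>\<Sum>l\<in>S. c l \<cdot> B (x l, \<dots>, x l)\<parallel> \<le> \<parallel>B (w 0, \<dots>, w (k - 1))\<parallel>\<close>, where \<open>S\<close> is finite, the scalars
  \<open>c l\<close> have norm 1, and every \<open>w i\<close> is some combination of the \<open>x l\<close> with \<open>l \<in> S\<close> and coefficients
  of norm 1 (\<open>diagonal_sum_le_multilinear\<close>). Averaged over all signs, the sum of
  \<open>e l \<cdot> e i \<cdot> G l i\<close> is the diagonal sum of \<open>G l l\<close>, hence some choice of signs does not decrease the
  norm; applied one slot at a time, this replaces the common index \<open>l\<close> in each slot by a full
  signed sum.

  If \<open>\<Sum>x i\<close> converges unconditionally, all finite sums over far indices are small, hence so are all
  signed ones, so \<open>B (w 0, \<dots>)\<close> is small by boundedness of \<open>B\<close>: finite sums of the \<open>Q (x i)\<close> over far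
  indices are small too.

  If \<open>\<Sum>x i\<close> is weakly unconditionally Cauchy, compose \<open>Q\<close> with a functional, so that \<open>B\<close> is
  scalar valued, and choose \<open>c l\<close> such that \<open>c l \<cdot> Q (x l) = \<bar>Q (x l)\<bar>\<close>. It remains to bound \<open>B\<close>
  on combinations with unimodular coefficients. Uniform boundedness on the Banach space \<open>E\<^sup>*\<close> gives
  \<open>\<Sum>\<bar>g (x i)\<bar> \<le> M \<parallel>g\<parallel>\<close> for all functionals \<open>g\<close>
  (\<open>weakly_unconditionally_Cauchy_uniform_bound\<close>). With all other slots fixed, \<open>B\<close> is such a
  functional, and freezing the slots one after the other yields \<open>\<bar>B (w 0, \<dots>)\<bar> \<le> \<parallel>B\<parallel> M\<^sup>k\<close>.
\<close>

section \<open>Sums along the diagonal of a multilinear map\<close>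

text \<open>
  The average of the right-hand sum over independent signs \<open>e\<close> is the diagonal sum. The translation
  \<open>y\<close> allows the signs to be picked one at a time, each by
  \<open>2 * norm a \<le> norm (a + b) + norm (a - b)\<close>.
\<close>

lemma signs_dominate_diagonal:
  fixes G :: "'i \<Rightarrow> 'i \<Rightarrow> 'b::real_normed_vector"
  assumes "finite S"
  shows "\<exists>e::'i \<Rightarrow> real. (\<forall>i. e i = 1 \<or> e i = -1) \<and>
    norm (y + (\<Sum>l\<in>S. G l l)) \<le> norm (y + (\<Sum>l\<in>S. \<Sum>i\<in>S. (e l * e i) *\<^sub>R G l i))"
  using assms
proof (induction S arbitrary: y rule: finite_induct)
  case empty
  show ?case by (intro exI[of _ "\<lambda>_. 1"]) simp
next
  case (insert s S)
  from insert.IH[of "y + G s s"] obtain e :: "'i \<Rightarrow> real" where e: "\<And>i. e i = 1 \<or> e i = -1"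
    and le: "norm (y + G s s + (\<Sum>l\<in>S. G l l))
      \<le> norm (y + G s s + (\<Sum>l\<in>S. \<Sum>i\<in>S. (e l * e i) *\<^sub>R G l i))"
    by blast
  define a where "a = y + G s s + (\<Sum>l\<in>S. \<Sum>i\<in>S. (e l * e i) *\<^sub>R G l i)"
  define b where "b = (\<Sum>i\<in>S. e i *\<^sub>R G s i) + (\<Sum>i\<in>S. e i *\<^sub>R G i s)"
  have "norm a \<le> norm (a + b) \<or> norm a \<le> norm (a - b)"
  proof (rule ccontr)
    assume "\<not> ?thesis"
    moreover have "2 * norm a \<le> norm (a + b) + norm (a - b)"
      using norm_triangle_ineq[of "a + b" "a - b"] by (simp flip: scaleR_2)
    ultimately show False by linarith
  qed
  then obtain t :: real where t: "t = 1 \<or> t = -1" and at: "norm a \<le> norm (a + t *\<^sub>R b)"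
    by (metis diff_conv_add_uminus scaleR_minus1_left scaleR_one)
  define e' where "e' = e(s := t)"
  have e'S: "e' i = e i" if "i \<in> S" for i
    using that insert.hyps by (auto simp: e'_def)
  have e's: "e' s = t" by (simp add: e'_def)
  have tt: "t * t = 1" using t by auto
  have "(\<Sum>l\<in>insert s S. \<Sum>i\<in>insert s S. (e' l * e' i) *\<^sub>R G l i)
      = G s s + t *\<^sub>R b + (\<Sum>l\<in>S. \<Sum>i\<in>S. (e l * e i) *\<^sub>R G l i)"
    using insert.hyps tt
    by (simp add: e's e'S sum.distrib b_def scaleR_right_distrib scaleR_sum_right mult.commute
        algebra_simps)
  hence "norm (y + (\<Sum>l\<in>insert s S. G l l))
      \<le> norm (y + (\<Sum>l\<in>insert s S. \<Sum>i\<in>insert s S. (e' l * e' i) *\<^sub>R G l i))"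
    using le at insert.hyps by (simp add: a_def algebra_simps)
  moreover have "\<forall>i. e' i = 1 \<or> e' i = -1"
    using e t by (auto simp: e'_def)
  ultimately show ?case by blast
qed

text \<open>
  The argument \<open>v\<close> ranges over all functions, not only over the extensional ones, so that slots can
  be updated freely; entries outside \<open>{..<k}\<close> are left unconstrained.
\<close>

definition slotwise_linear ::
  "('k::field \<Rightarrow> 'a::ab_group_add \<Rightarrow> 'a) \<Rightarrow> ('k \<Rightarrow> 'b::ab_group_add \<Rightarrow> 'b) \<Rightarrow> nat
    \<Rightarrow> ((nat \<Rightarrow> 'a) \<Rightarrow> 'b) \<Rightarrow> bool" where
  "slotwise_linear s1 s2 k B \<longleftrightarrow>
     (\<forall>v. \<forall>i<k. Vector_Spaces.linear s1 s2 (\<lambda>u. B (v(i := u))))"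

definition unimodular_sums ::
  "('k::real_normed_field \<Rightarrow> 'a::ab_group_add \<Rightarrow> 'a) \<Rightarrow> ('i \<Rightarrow> 'a) \<Rightarrow> 'i set \<Rightarrow> 'a set" where
  "unimodular_sums smul x S = {\<Sum>i\<in>S. smul (c i) (x i) | c. \<forall>i. norm (c i) = 1}"

text \<open>
  Slots up to \<open>m\<close> carry the summation index, the others carry the parameters \<open>v\<close>. Dominating the
  diagonal by signs turns slot \<open>m\<close> into the parameter \<open>\<Sum>i\<in>S. e i \<cdot> x i\<close> and the coefficient \<open>c l\<close> into
  \<open>e l \<cdot> c l\<close>, again of norm 1; linearity in slot 0 absorbs the remaining coefficients.
\<close>

lemma diagonal_sum_le_multilinear:
  fixes smulE :: "'k::{real_normed_field, banach} \<Rightarrow> 'a::banach \<Rightarrow> 'a"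
    and smulF :: "'k \<Rightarrow> 'b::banach \<Rightarrow> 'b"
  assumes E: "banach_space_over smulE" and F: "banach_space_over smulF"
    and B: "slotwise_linear smulE smulF k B"
    and S: "finite S" and "m < k" and "\<And>l. norm (c l) = 1"
  shows "\<exists>w. (\<forall>i\<le>m. w i \<in> unimodular_sums smulE x S) \<and> (\<forall>i>m. w i = v i) \<and>
    norm (\<Sum>l\<in>S. smulF (c l) (B (\<lambda>i. if i \<le> m then x l else v i))) \<le> norm (B w)"
  using assms(5,6)
proof (induction m arbitrary: v c)
  interpret E: banach_space_over smulE by (rule E)
  interpret F: banach_space_over smulF by (rule F)
  {
    case 0
    interpret L: Vector_Spaces.linear smulE smulF "\<lambda>u. B (v(0 := u))"
      using B 0 by (simp add: slotwise_linear_def)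
    let ?u = "\<Sum>l\<in>S. smulE (c l) (x l)"
    have upd: "(\<lambda>i. if i \<le> (0::nat) then u else v i) = v(0 := u)" for u
      by auto
    have "?u \<in> unimodular_sums smulE x S"
      using 0 by (auto simp: unimodular_sums_def)
    moreover have "(\<Sum>l\<in>S. smulF (c l) (B (v(0 := x l)))) = B (v(0 := ?u))"
      by (simp add: L.sum L.scale)
    ultimately show ?case
      unfolding upd by (intro exI[of _ "v(0 := ?u)"] conjI) (simp, simp, simp only: order_refl)
  next
    case (Suc m)
    define G where "G = (\<lambda>l a. B (\<lambda>i. if i \<le> m then x l else (v(Suc m := a)) i))"
    have linF: "Vector_Spaces.linear smulE smulF (G l)" for l
    proof -
      have "G l = (\<lambda>u. B ((\<lambda>i. if i \<le> m then x l else v i)(Suc m := u)))"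
        unfolding G_def by (intro ext arg_cong[of _ _ B]) auto
      thus ?thesis using B Suc.prems by (simp add: slotwise_linear_def)
    qed
    from signs_dominate_diagonal[OF S, of 0 "\<lambda>l i. smulF (c l) (G l (x i))"]
    obtain e :: "'c \<Rightarrow> real" where e: "\<And>i. e i = 1 \<or> e i = -1"
      and le: "norm (\<Sum>l\<in>S. smulF (c l) (G l (x l)))
        \<le> norm (\<Sum>l\<in>S. \<Sum>i\<in>S. (e l * e i) *\<^sub>R smulF (c l) (G l (x i)))"
      by auto
    have ne: "norm (of_real (e i) :: 'k) = 1" for i
      using e[of i] by auto
    define u where "u = (\<Sum>i\<in>S. smulE (of_real (e i)) (x i))"
    have u: "u \<in> unimodular_sums smulE x S"
      using ne by (auto simp: unimodular_sums_def u_def)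
    have "(\<Sum>i\<in>S. (e l * e i) *\<^sub>R smulF (c l) (G l (x i))) = smulF (of_real (e l) * c l) (G l u)"
      for l
    proof -
      interpret L: Vector_Spaces.linear smulE smulF "G l" by (rule linF)
      have "(\<Sum>i\<in>S. (e l * e i) *\<^sub>R smulF (c l) (G l (x i)))
          = (\<Sum>i\<in>S. smulF (of_real (e l) * c l) (G l (smulE (of_real (e i)) (x i))))"
        by (intro sum.cong refl) (simp add: L.scale mult_ac flip: F.smul_of_real)
      thus ?thesis by (simp add: u_def L.sum F.scale_sum_right)
    qed
    with le have le': "norm (\<Sum>l\<in>S. smulF (c l) (G l (x l)))
        \<le> norm (\<Sum>l\<in>S. smulF (of_real (e l) * c l) (G l u))" by simp
    have unimod: "norm (of_real (e l) * c l) = 1" for l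
      using ne Suc.prems by (simp add: norm_mult)
    from Suc.IH[where v = "v(Suc m := u)" and c = "\<lambda>l. of_real (e l) * c l"] unimod Suc.prems(1)
    obtain w where w: "\<And>i. i \<le> m \<Longrightarrow> w i \<in> unimodular_sums smulE x S"
        "\<And>i. i > m \<Longrightarrow> w i = (v(Suc m := u)) i"
      and wle: "norm (\<Sum>l\<in>S. smulF (of_real (e l) * c l) (G l u)) \<le> norm (B w)"
      unfolding G_def by auto
    have *: "B (\<lambda>i. if i \<le> Suc m then x l else v i) = G l (x l)" for l
      unfolding G_def by (intro arg_cong[of _ _ B]) auto
    have "w i \<in> unimodular_sums smulE x S" if "i \<le> Suc m" for i
      using that w u by (cases "i = Suc m") auto
    moreover have "w i = v i" if "i > Suc m" for i
      using that w by auto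
    ultimately show ?case
      unfolding * using le' wle by (intro exI[of _ w]) auto
  }
qed

section \<open>Homogeneous polynomials as diagonals of bounded multilinear maps\<close>

lemma slotwise_linear_scaleR:
  fixes smulE :: "'k::{real_normed_field, banach} \<Rightarrow> 'a::banach \<Rightarrow> 'a"
    and smulF :: "'k \<Rightarrow> 'b::banach \<Rightarrow> 'b"
  assumes "banach_space_over smulE" and "banach_space_over smulF"
    and "slotwise_linear smulE smulF k B"
  shows "slotwise_linear scaleR scaleR k B"
  using assms unfolding slotwise_linear_def
  by (auto simp: Vector_Spaces.linear_iff real_vector.vector_space_axioms
      simp flip: banach_space_over.smul_of_real)

lemma slotwise_linear_scale_prod:
  fixes B :: "(nat \<Rightarrow> 'a::real_vector) \<Rightarrow> 'b::real_vector"
  assumes B: "slotwise_linear scaleR scaleR k B" and "j \<le> k"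
  shows "B (\<lambda>i. if i < j then r i *\<^sub>R v i else v i) = (\<Prod>i<j. r i) *\<^sub>R B v"
  using assms(2)
proof (induction j)
  case (Suc j)
  let ?f = "\<lambda>i. if i < j then r i *\<^sub>R v i else v i"
  interpret L: Vector_Spaces.linear scaleR scaleR "\<lambda>u. B (?f(j := u))"
    using B Suc.prems by (simp add: slotwise_linear_def)
  have 1: "(\<lambda>i. if i < Suc j then r i *\<^sub>R v i else v i) = ?f(j := r j *\<^sub>R v j)"
    by auto
  have 2: "?f = ?f(j := v j)" by auto
  show ?case
    unfolding 1 L.scale using Suc 2 by (simp add: mult.commute)
qed simp

text \<open>
  Continuity of the multilinear map at the zero tuple bounds it on a box of radius \<open>\<delta>\<close>; scaling
  each slot to length \<open>\<delta>\<close> turns this into the product bound. For \<open>k = 0\<close> the empty product makes the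
  bound one for the constant, which is why the box is mapped near \<open>A 0\<close> and not near \<open>0\<close>.
\<close>

lemma homogeneous_polynomial_form:
  fixes smulE :: "'k::{real_normed_field, banach} \<Rightarrow> 'a::banach \<Rightarrow> 'a"
    and smulF :: "'k \<Rightarrow> 'b::banach \<Rightarrow> 'b"
  assumes E: "banach_space_over smulE" and F: "banach_space_over smulF"
    and Q: "continuous_homogeneous_polynomial smulE smulF k Q"
  obtains B C where "slotwise_linear smulE smulF k B"
    and "C \<ge> 0" and "\<And>v. norm (B v) \<le> C * (\<Prod>i<k. norm (v i))"
    and "\<And>x v. Q x = B (\<lambda>i. if i < k then x else v i)"
proof -
  from Q obtain A where A: "continuous_symmetric_multilinear smulE smulF k A"
    and QA: "\<And>x. Q x = A (\<lambda>i\<in>{..<k}. x)"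
    by (auto simp: continuous_homogeneous_polynomial_def)
  define B where "B v = A (restrict v {..<k})" for v
  have lin: "slotwise_linear smulE smulF k B"
    unfolding slotwise_linear_def
  proof (intro allI impI)
    fix v i assume "i < k"
    hence "(\<lambda>u. B (v(i := u))) = (\<lambda>u. A ((restrict v {..<k})(i := u)))"
      unfolding B_def by (intro ext arg_cong[of _ _ A]) (auto simp: restrict_def)
    thus "Vector_Spaces.linear smulE smulF (\<lambda>u. B (v(i := u)))"
      using A \<open>i < k\<close> by (simp add: continuous_symmetric_multilinear_def)
  qed
  have linR: "slotwise_linear scaleR scaleR k B"
    by (rule slotwise_linear_scaleR[OF E F lin])
  let ?X = "product_topology (\<lambda>_. euclidean) {..<k} :: (nat \<Rightarrow> 'a) topology"
  let ?z = "\<lambda>i\<in>{..<k}. 0 :: 'a"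
  define D where "D = norm (A ?z) + 1"
  define W where "W = {v \<in> topspace ?X. A v \<in> ball (A ?z) 1}"
  have "openin ?X W"
    unfolding W_def
    using A by (intro openin_continuous_map_preimage[of _ euclidean])
      (auto simp: continuous_symmetric_multilinear_def)
  hence "\<forall>z\<in>W. \<exists>U. finite {i \<in> {..<k}. U i \<noteq> topspace euclidean} \<and>
      (\<forall>i\<in>{..<k}. openin euclidean (U i)) \<and> z \<in> Pi\<^sub>E {..<k} U \<and> Pi\<^sub>E {..<k} U \<subseteq> W"
    by (simp only: openin_product_topology_alt)
  moreover have "?z \<in> W"
    by (simp add: W_def)
  ultimately obtain U where "\<forall>i\<in>{..<k}. openin euclidean (U i)" and U2: "?z \<in> Pi\<^sub>E {..<k} U"
    and U3: "Pi\<^sub>E {..<k} U \<subseteq> W"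
    by (elim ballE[of _ _ ?z]) auto
  hence U1: "\<And>i. i < k \<Longrightarrow> open (U i)"
    by simp
  have "\<exists>d>0. cball 0 d \<subseteq> U i" if "i < k" for i
  proof -
    have "0 \<in> U i" using U2 that by (auto simp: PiE_iff restrict_def)
    thus ?thesis using U1[OF that] open_contains_cball by blast
  qed
  then obtain d where d: "\<And>i. i < k \<Longrightarrow> d i > 0 \<and> cball 0 (d i) \<subseteq> U i"
    by metis
  define \<delta> where "\<delta> = Min (insert 1 (d ` {..<k}))"
  have \<delta>: "\<delta> > 0" "\<And>i. i < k \<Longrightarrow> \<delta> \<le> d i"
    using d by (auto simp: \<delta>_def)
  have small: "norm (B v) \<le> D" if "\<And>i. i < k \<Longrightarrow> norm (v i) \<le> \<delta>" for v
  proof -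
    have "restrict v {..<k} \<in> Pi\<^sub>E {..<k} U"
      using that d \<delta> by (force simp: PiE_iff)
    hence "dist (A ?z) (B v) < 1" using subsetD[OF U3] by (simp add: B_def W_def)
    thus ?thesis
      using norm_triangle_ineq2[of "B v" "A ?z"] by (simp add: D_def dist_norm norm_minus_commute)
  qed
  define C where "C = D / \<delta> ^ k"
  have "C \<ge> 0" using \<delta> by (simp add: C_def D_def)
  moreover have "norm (B v) \<le> C * (\<Prod>i<k. norm (v i))" for v
  proof (cases "\<exists>i<k. v i = 0")
    case True
    then obtain i where i: "i < k" "v i = 0" by blast
    interpret L: Vector_Spaces.linear smulE smulF "\<lambda>u. B (v(i := u))"
      using lin i by (simp add: slotwise_linear_def)
    have "B v = B (v(i := 0))" using i by (simp add: fun_upd_idem)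
    hence "B v = 0" using L.zero by simp
    thus ?thesis using \<open>C \<ge> 0\<close> by (simp add: prod_nonneg)
  next
    case False
    define r where "r i = \<delta> / norm (v i)" for i
    have "norm (B (\<lambda>i. if i < k then r i *\<^sub>R v i else v i)) \<le> D"
      using False \<delta> by (intro small) (simp add: r_def)
    hence "(\<Prod>i<k. \<bar>r i\<bar>) * norm (B v) \<le> D"
      by (simp add: slotwise_linear_scale_prod[OF linR] abs_prod)
    moreover have "(\<Prod>i<k. \<bar>r i\<bar>) = \<delta> ^ k / (\<Prod>i<k. norm (v i))"
      using \<delta> by (simp add: r_def prod_dividef)
    moreover have "(\<Prod>i<k. norm (v i)) > 0"
      using False by (intro prod_pos) auto
    ultimately show ?thesis
      using \<delta> by (simp add: C_def field_simps)
  qed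
  moreover have "Q x = B (\<lambda>i. if i < k then x else v i)" for x v
    unfolding QA B_def by (intro arg_cong[of _ _ A]) (auto simp: restrict_def)
  ultimately show ?thesis using that lin by blast
qed

lemma banach_space_over_scaleR: "banach_space_over (scaleR :: real \<Rightarrow> 'a::banach \<Rightarrow> 'a)"
  by (simp add: banach_space_over_def banach_space_over_axioms_def
      real_vector.vector_space_axioms)

lemma banach_space_over_mult:
  "banach_space_over ((*) :: 'k::{real_normed_field, banach} \<Rightarrow> 'k \<Rightarrow> 'k)"
  by (simp add: banach_space_over_def banach_space_over_axioms_def norm_mult scaleR_conv_of_real
      vector_space_over_itself.vector_space_axioms)

section \<open>Unconditionally converging series\<close>

text \<open>
  If finite sums over far indices were not small, there would be finite sets in successive disjoint
  intervals, each with a sum of norm at least \<open>e\<close>; the subseries over their union is not Cauchy.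
\<close>

lemma unconditionally_converging_iff_small_tails:
  fixes x :: "nat \<Rightarrow> 'a::banach"
  shows "unconditionally_converging x \<longleftrightarrow>
    (\<forall>e>0. \<exists>N. \<forall>S. finite S \<longrightarrow> S \<subseteq> {N..} \<longrightarrow> norm (sum x S) < e)"
    (is "?L \<longleftrightarrow> ?R")
proof
  assume R: ?R
  show ?L
    unfolding unconditionally_converging_def
  proof (intro allI impI)
    fix r :: "nat \<Rightarrow> nat" assume r: "strict_mono r"
    show "summable (\<lambda>j. x (r j))"
      unfolding summable_Cauchy
    proof (intro allI impI)
      fix e :: real assume "e > 0"
      with R obtain N where N: "\<And>S. finite S \<Longrightarrow> S \<subseteq> {N..} \<Longrightarrow> norm (sum x S) < e"
        by metis
      have "norm (\<Sum>j=m..<n. x (r j)) < e" if "m \<ge> N" for m n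
      proof -
        have "(\<Sum>j=m..<n. x (r j)) = sum x (r ` {m..<n})"
          using r by (subst sum.reindex) (auto intro: inj_on_subset strict_mono_imp_inj_on)
        moreover have "r ` {m..<n} \<subseteq> {N..}"
          using that strict_mono_imp_increasing[OF r] by (meson atLeastLessThan_iff atLeast_iff image_subsetI order_trans)
        ultimately show ?thesis using N by simp
      qed
      thus "\<exists>N. \<forall>m\<ge>N. \<forall>n. norm (\<Sum>j=m..<n. x (r j)) < e" by blast
    qed
  qed
next
  assume L: ?L
  show ?R
  proof (rule ccontr)
    assume "\<not> ?R"
    then obtain e F where e: "e > 0"
      and F: "\<And>N. finite (F N)" "\<And>N. F N \<subseteq> {N..}" "\<And>N. e \<le> norm (sum x (F N))"
      by (simp add: not_less) metis
    define p where "p = rec_nat (0::nat) (\<lambda>_ N. Suc (Max (insert N (F N))))"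
    have p_Suc: "p (Suc j) = Suc (Max (insert (p j) (F (p j))))" for j
      by (simp add: p_def)
    have block: "F (p j) \<subseteq> {p j..<p (Suc j)}" for j
      using F(1,2)[of "p j"] by (auto simp: p_Suc less_Suc_eq_le intro: Max_ge)
    have p: "strict_mono p"
      using F(1) by (auto simp: strict_mono_Suc_iff p_Suc less_Suc_eq_le intro: Max_ge)
    (* block j of the bad subseries lives in the interval from p j to p (Suc j) *)
    define T where "T = (\<Union>j. F (p j))"
    have T_block: "T \<inter> {p j..<p (Suc j)} = F (p j)" for j
    proof -
      have "i \<in> F (p j)" if "i \<in> F (p l)" "p j \<le> i" "i < p (Suc j)" for i l
      proof -
        have "i \<in> {p l..<p (Suc l)}"
          using block[of l] that(1) by blast
        hence "p l < p (Suc j)" "p j < p (Suc l)"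
          using that(2,3) by simp_all
        hence "l = j" using p by (simp add: strict_mono_less)
        thus ?thesis using that by simp
      qed
      thus ?thesis using block[of j] by (auto simp: T_def)
    qed
    have "infinite T"
      unfolding infinite_nat_iff_unbounded_le
    proof
      fix n
      have "F (p n) \<noteq> {}" using F(3)[of "p n"] e by auto
      then obtain i where i: "i \<in> F (p n)" by blast
      hence "p n \<le> i" using F(2)[of "p n"] by auto
      hence "n \<le> i" using strict_mono_imp_increasing[OF p, of n] by linarith
      thus "\<exists>i\<ge>n. i \<in> T" using i by (auto simp: T_def)
    qed
    define y where "y i = (if i \<in> T then x i else 0)" for i
    have "summable (\<lambda>j. y (enumerate T j))"
      using L strict_mono_enumerate[OF \<open>infinite T\<close>] enumerate_in_set[OF \<open>infinite T\<close>]
      by (simp add: unconditionally_converging_def y_def)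
    hence "summable y"
      using summable_mono_reindex[OF strict_mono_enumerate[OF \<open>infinite T\<close>], of y]
        range_enumerate[OF \<open>infinite T\<close>] by (simp add: y_def)
    then obtain N where N: "\<And>m n. m \<ge> N \<Longrightarrow> norm (sum y {m..<n}) < e"
      using e unfolding summable_Cauchy by metis
    have "sum y {p N..<p (Suc N)} = sum x (F (p N))"
      unfolding T_block[symmetric] y_def by (simp add: Int_commute[of T] sum.inter_restrict)
    with N[of "p N" "p (Suc N)"] F(3)[of "p N"] strict_mono_imp_increasing[OF p, of N]
    show False by simp
  qed
qed

text \<open>
  Over the reals unimodular coefficients are signs, so such a combination is a difference of two
  subsums.
\<close>

lemma norm_signed_sum_le:
  fixes x :: "'i \<Rightarrow> 'a::banach"
  assumes u: "u \<in> unimodular_sums scaleR x S" and S: "finite S"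
    and d: "\<And>T. T \<subseteq> S \<Longrightarrow> norm (sum x T) \<le> d"
  shows "norm u \<le> 2 * d"
proof -
  from u obtain c :: "'i \<Rightarrow> real" where c: "\<And>i. norm (c i) = 1" and ueq: "u = (\<Sum>i\<in>S. c i *\<^sub>R x i)"
    by (auto simp: unimodular_sums_def)
  have "c i *\<^sub>R x i = (if c i = 1 then x i else 0) - (if c i = -1 then x i else 0)" for i
    using c[of i] by (auto simp: abs_if split: if_splits)
  hence "u = sum x {i\<in>S. c i = 1} - sum x {i\<in>S. c i = -1}"
    unfolding ueq using S by (simp add: sum_subtractf sum.inter_filter)
  also have "norm \<dots> \<le> norm (sum x {i\<in>S. c i = 1}) + norm (sum x {i\<in>S. c i = -1})"
    by (rule norm_triangle_ineq4)
  also have "\<dots> \<le> d + d"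
    by (intro add_mono d) auto
  finally show ?thesis by simp
qed

text \<open>
  The spaces are used as real spaces here: then the sums \<open>w i\<close> have coefficients \<open>\<plusminus>1\<close> and inherit
  smallness from the partial sums, whereas general unimodular coefficients would not be controlled
  by the hypothesis directly.
\<close>

lemma homogeneous_polynomial_unconditionally_converging:
  fixes smulE :: "'k::{real_normed_field, banach} \<Rightarrow> 'a::banach \<Rightarrow> 'a"
    and smulF :: "'k \<Rightarrow> 'b::banach \<Rightarrow> 'b"
  assumes E: "banach_space_over smulE" and F: "banach_space_over smulF"
    and Q: "continuous_homogeneous_polynomial smulE smulF (Suc m) Q"
    and x: "unconditionally_converging x"
  shows "unconditionally_converging (\<lambda>i. Q (x i))"
  unfolding unconditionally_converging_iff_small_tails
proof (intro allI impI)
  fix e :: real assume "e > 0"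
  from homogeneous_polynomial_form[OF E F Q] obtain B C where
    B: "slotwise_linear smulE smulF (Suc m) B" and "C \<ge> 0"
    and C: "\<And>v. norm (B v) \<le> C * (\<Prod>i<Suc m. norm (v i))"
    and QB: "\<And>x v. Q x = B (\<lambda>i. if i < Suc m then x else v i)"
    by blast
  (* d \<le> 1 makes d ^ Suc m at most d, so a bound on C * d suffices in every degree *)
  define d where "d = min 1 (e / (C + 1))"
  have d: "d > 0" "d \<le> 1" "C * d < e"
  proof -
    show "d > 0" "d \<le> 1" using \<open>e > 0\<close> \<open>C \<ge> 0\<close> by (auto simp: d_def)
    have "C * d \<le> C * (e / (C + 1))"
      using \<open>C \<ge> 0\<close> by (intro mult_left_mono) (auto simp: d_def)
    also have "\<dots> < e" using \<open>e > 0\<close> \<open>C \<ge> 0\<close> by (simp add: field_simps)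
    finally show "C * d < e" .
  qed
  from x d obtain N where N: "\<And>S. finite S \<Longrightarrow> S \<subseteq> {N..} \<Longrightarrow> norm (sum x S) < d / 2"
    unfolding unconditionally_converging_iff_small_tails by (metis half_gt_zero)
  have "norm (\<Sum>i\<in>S. Q (x i)) < e" if S: "finite S" "S \<subseteq> {N..}" for S
  proof -
    from diagonal_sum_le_multilinear[OF banach_space_over_scaleR banach_space_over_scaleR
        slotwise_linear_scaleR[OF E F B] S(1), of m "\<lambda>_. 1" x undefined]
    obtain w where w: "\<And>i. i \<le> m \<Longrightarrow> w i \<in> unimodular_sums scaleR x S"
      and le: "norm (\<Sum>l\<in>S. Q (x l)) \<le> norm (B w)"
      unfolding QB[of _ undefined] less_Suc_eq_le by auto
    have "norm (w i) \<le> d" if "i < Suc m" for i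
    proof -
      have "norm (sum x T) \<le> d / 2" if "T \<subseteq> S" for T
        using N[of T] that S finite_subset[OF that] by fastforce
      with norm_signed_sum_le[OF w S(1), of i "d / 2"] that show ?thesis by simp
    qed
    hence "(\<Prod>i<Suc m. norm (w i)) \<le> (\<Prod>i<Suc m. d)"
      by (intro prod_mono) auto
    also have "\<dots> \<le> d" using d power_decreasing[of 1 "Suc m" d] by simp
    finally have "C * (\<Prod>i<Suc m. norm (w i)) \<le> C * d"
      using \<open>C \<ge> 0\<close> by (intro mult_left_mono)
    with le C[of w] d show ?thesis by linarith
  qed
  thus "\<exists>N. \<forall>S. finite S \<longrightarrow> S \<subseteq> {N..} \<longrightarrow> norm (\<Sum>i\<in>S. Q (x i)) < e" by blast
qed

section \<open>Weakly unconditionally Cauchy series\<close>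

text \<open>
  This is the uniform boundedness principle on the dual space, realised as the closed subspace \<open>D\<close>
  of the bounded real-linear maps into the scalars: \<open>D\<close> is the union of the closed sets \<open>V n\<close> of
  functionals with \<open>\<Sum>\<bar>T (x i)\<bar> \<le> n\<close>, so by Baire some \<open>V n\<close> contains a ball around some \<open>T0\<close>, and
  differences with \<open>T0\<close> carry the bound over to a ball around 0.
\<close>

lemma weakly_unconditionally_Cauchy_uniform_bound:
  fixes smulE :: "'k::{real_normed_field, banach} \<Rightarrow> 'a::banach \<Rightarrow> 'a"
  assumes E: "banach_space_over smulE" and x: "weakly_unconditionally_Cauchy smulE x"
  obtains M where "M \<ge> 0"
    and "\<And>g K S. Vector_Spaces.linear smulE (*) g \<Longrightarrow> K \<ge> 0 \<Longrightarrow>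
      (\<And>y. norm (g y) \<le> K * norm y) \<Longrightarrow> finite S \<Longrightarrow> (\<Sum>i\<in>S. norm (g (x i))) \<le> M * K"
proof -
  interpret E: banach_space_over smulE by (rule E)
  define D where "D = {T :: 'a \<Rightarrow>\<^sub>L 'k. \<forall>c y. blinfun_apply T (smulE c y) = c * blinfun_apply T y}"
  define V where "V n = {T \<in> D. \<forall>j. (\<Sum>i<j. norm (blinfun_apply T (x i))) \<le> real n}" for n :: nat
  have "closed D"
    unfolding D_def by (intro closed_Collect_all closed_Collect_eq continuous_intros)
  have closedV: "closed (V n)" for n
  proof -
    have "V n = D \<inter> {T. \<forall>j. (\<Sum>i<j. norm (blinfun_apply T (x i))) \<le> real n}"
      by (auto simp: V_def)
    thus ?thesis
      using \<open>closed D\<close>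
      by (simp add: closed_Int closed_Collect_all closed_Collect_le continuous_intros)
  qed
  have "D \<subseteq> (\<Union>n. V n)"
  proof
    fix T assume "T \<in> D"
    hence "blinfun_apply T \<in> dual_space smulE"
      by (auto simp: dual_space_def D_def Vector_Spaces.linear_iff E.vector_space_axioms
          vector_space_over_itself.vector_space_axioms blinfun.add_right intro: continuous_intros)
    hence sm: "summable (\<lambda>i. norm (blinfun_apply T (x i)))"
      using x by (auto simp: weakly_unconditionally_Cauchy_def)
    obtain n :: nat where "(\<Sum>i. norm (blinfun_apply T (x i))) \<le> real n"
      using real_arch_simple by blast
    hence "(\<Sum>i<j. norm (blinfun_apply T (x i))) \<le> real n" for j
      using sum_le_suminf[OF sm, of "{..<j}"] by fastforce
    thus "T \<in> (\<Union>n. V n)" using \<open>T \<in> D\<close> by (auto simp: V_def)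
  qed
  hence VD: "\<Union>(range V) = D" by (auto simp: V_def)
  have "\<exists>n. top_of_set D interior_of (V n) \<noteq> {}"
  proof (rule ccontr)
    assume none: "\<not> ?thesis"
    have "closedin (top_of_set D) (V n)" for n
      using closedV by (intro closed_subset) (auto simp: V_def)
    hence "top_of_set D interior_of \<Union>(range V) = {}"
      using none \<open>closed D\<close>
      by (intro Baire_category_alt disjI1 completely_metrizable_space_closedin[where X = euclidean])
        (auto simp: completely_metrizable_space_euclidean)
    moreover have "0 \<in> D" by (simp add: D_def)
    ultimately show False
      using VD interior_of_topspace[of "top_of_set D"] by auto
  qed
  then obtain n T0 where "T0 \<in> top_of_set D interior_of (V n)" by blast
  then obtain W where "openin (top_of_set D) W" "T0 \<in> W" "W \<subseteq> V n"
    by (auto simp: interior_of_def)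
  then obtain r where r: "r > 0" and "ball T0 r \<inter> D \<subseteq> V n" "T0 \<in> V n"
    unfolding openin_contains_ball by blast
  hence near: "T \<in> V n" if "T \<in> D" "norm (T - T0) < r" for T
    using that by (auto simp: dist_norm norm_minus_commute)
  show ?thesis
  proof (rule that[of "4 * real n / r"])
    show "0 \<le> 4 * real n / r" using r by simp
    fix g :: "'a \<Rightarrow> 'k" and K :: real and S :: "nat set"
    assume g: "Vector_Spaces.linear smulE (*) g" and "K \<ge> 0"
      and K: "\<And>y. norm (g y) \<le> K * norm y" and S: "finite S"
    interpret g: Vector_Spaces.linear smulE "(*)" g by (rule g)
    show "(\<Sum>i\<in>S. norm (g (x i))) \<le> 4 * real n / r * K"
    proof (cases "K = 0")
      case True
      thus ?thesis using K by simp
    next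
      case False
      with \<open>K \<ge> 0\<close> have "K > 0" by simp
      (* t shrinks g to norm at most r / 2, inside the ball around T0 *)
      define t where "t = r / (2 * K)"
      have t: "t > 0" using r \<open>K > 0\<close> by (simp add: t_def)
      have "bounded_linear g"
      proof (rule bounded_linear_intro[of _ K])
        show "g (s *\<^sub>R y) = s *\<^sub>R g y" for s y
          using g.scale[of "of_real s" y] by (simp add: E.smul_of_real scaleR_conv_of_real)
      qed (use K in \<open>auto simp: g.add mult.commute\<close>)
      hence app: "blinfun_apply (Blinfun g) = g"
        by (rule bounded_linear_Blinfun_apply)
      let ?T = "T0 + t *\<^sub>R Blinfun g"
      have "norm (Blinfun g) \<le> K"
        using K \<open>K \<ge> 0\<close> by (intro norm_blinfun_bound) (simp_all add: app)
      hence "norm (t *\<^sub>R Blinfun g) \<le> t * K" using t by simp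
      also have "\<dots> < r" using r \<open>K > 0\<close> by (simp add: t_def)
      finally have "norm (?T - T0) < r" by simp
      moreover have "?T \<in> D"
        using \<open>T0 \<in> V n\<close>
        by (auto simp: V_def D_def blinfun.add_left blinfun.scaleR_left app g.scale algebra_simps)
      ultimately have T: "?T \<in> V n" by (rule near[rotated])
      obtain j where j: "S \<subseteq> {..<j}" using S finite_nat_iff_bounded by blast
      have "t * (\<Sum>i\<in>S. norm (g (x i))) \<le> t * (\<Sum>i<j. norm (g (x i)))"
        using t j by (intro mult_left_mono sum_mono2) auto
      also have "\<dots> = (\<Sum>i<j. norm (blinfun_apply ?T (x i) - blinfun_apply T0 (x i)))"
        using t by (simp add: sum_distrib_left blinfun.add_left blinfun.scaleR_left app)
      also have "\<dots> \<le> (\<Sum>i<j. norm (blinfun_apply ?T (x i)) + norm (blinfun_apply T0 (x i)))"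
        by (intro sum_mono norm_triangle_ineq4)
      also have "\<dots> \<le> real n + real n"
        unfolding sum.distrib using T \<open>T0 \<in> V n\<close> by (intro add_mono) (auto simp: V_def)
      finally show ?thesis using r \<open>K > 0\<close> by (simp add: t_def field_simps)
    qed
  qed
qed

text \<open>
  The hypothesis on \<open>U\<close> says that \<open>U\<close> is bounded by \<open>M\<close> in the bidual. The bound on \<open>B\<close> comes slot by
  slot: once the first \<open>j\<close> slots lie in \<open>U\<close>, slot \<open>j\<close> is a functional of norm at most \<open>K\<close>, and
  restricting it to \<open>U\<close> costs one more factor \<open>M\<close>.
\<close>

lemma multilinear_form_bounded_on_weakly_bounded_set:
  fixes smulE :: "'k::{real_normed_field, banach} \<Rightarrow> 'a::banach \<Rightarrow> 'a"
    and B :: "(nat \<Rightarrow> 'a) \<Rightarrow> 'k"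
  assumes B: "slotwise_linear smulE (*) k B" and "C \<ge> 0"
    and C: "\<And>v. norm (B v) \<le> C * (\<Prod>i<k. norm (v i))"
    and "M \<ge> 0"
    and M: "\<And>g K u. Vector_Spaces.linear smulE (*) g \<Longrightarrow> K \<ge> 0 \<Longrightarrow>
      (\<And>y. norm (g y) \<le> K * norm y) \<Longrightarrow> u \<in> U \<Longrightarrow> norm (g u) \<le> M * K"
    and "\<And>i. i < k \<Longrightarrow> w i \<in> U"
  shows "norm (B w) \<le> C * M ^ k"
proof -
  have "norm (B v) \<le> C * M ^ j * (\<Prod>i=j..<k. norm (v i))"
    if "j \<le> k" and "\<And>i. i < j \<Longrightarrow> v i \<in> U" for v j
    using that
  proof (induction j arbitrary: v)
    case 0
    show ?case using C[of v] by (simp add: atLeast0LessThan)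
  next
    case (Suc j)
    define K where "K = C * M ^ j * (\<Prod>i=Suc j..<k. norm (v i))"
    have "K \<ge> 0" using \<open>C \<ge> 0\<close> \<open>M \<ge> 0\<close> by (simp add: K_def prod_nonneg)
    have "norm (B (v(j := y))) \<le> K * norm y" for y
    proof -
      have "(\<Prod>i=j..<k. norm ((v(j := y)) i)) = norm y * (\<Prod>i=Suc j..<k. norm (v i))"
        using Suc.prems(1) by (simp add: prod.atLeast_Suc_lessThan)
      moreover have "norm (B (v(j := y))) \<le> C * M ^ j * (\<Prod>i=j..<k. norm ((v(j := y)) i))"
        by (rule Suc.IH) (use Suc.prems in auto)
      ultimately show ?thesis
        by (simp only: K_def mult_ac)
    qed
    moreover have "Vector_Spaces.linear smulE (*) (\<lambda>y. B (v(j := y)))"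
      using B Suc.prems(1) by (simp add: slotwise_linear_def)
    ultimately have "norm (B (v(j := v j))) \<le> M * K"
      using M[of "\<lambda>y. B (v(j := y))" K "v j"] \<open>K \<ge> 0\<close> Suc.prems by simp
    thus ?case by (simp add: K_def mult_ac)
  qed
  from this[of k w] assms(6) show ?thesis by simp
qed

lemma homogeneous_scalar_polynomial_absolutely_summable:
  fixes smulE :: "'k::{real_normed_field, banach} \<Rightarrow> 'a::banach \<Rightarrow> 'a"
    and q :: "'a \<Rightarrow> 'k"
  assumes E: "banach_space_over smulE"
    and q: "continuous_homogeneous_polynomial smulE (*) (Suc m) q"
    and x: "weakly_unconditionally_Cauchy smulE x"
  shows "summable (\<lambda>i. norm (q (x i)))"
proof -
  from homogeneous_polynomial_form[OF E banach_space_over_mult q] obtain B C where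
    B: "slotwise_linear smulE (*) (Suc m) B" and "C \<ge> 0"
    and C: "\<And>v. norm (B v) \<le> C * (\<Prod>i<Suc m. norm (v i))"
    and qB: "\<And>x v. q x = B (\<lambda>i. if i < Suc m then x else v i)"
    by blast
  from weakly_unconditionally_Cauchy_uniform_bound[OF E x] obtain M where "M \<ge> 0"
    and M: "\<And>g K S. Vector_Spaces.linear smulE (*) g \<Longrightarrow> K \<ge> 0 \<Longrightarrow>
      (\<And>y. norm (g y) \<le> K * norm y) \<Longrightarrow> finite S \<Longrightarrow> (\<Sum>i\<in>S. norm (g (x i))) \<le> M * K"
    by blast
  have M': "norm (g u) \<le> M * K"
    if g: "Vector_Spaces.linear smulE (*) g" and K: "K \<ge> 0" "\<And>y. norm (g y) \<le> K * norm y"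
      and u: "u \<in> unimodular_sums smulE x S" and S: "finite S" for g K u S
  proof -
    interpret g: Vector_Spaces.linear smulE "(*)" g by (rule g)
    from u obtain c where c: "\<And>i. norm (c i) = 1" and ueq: "u = (\<Sum>i\<in>S. smulE (c i) (x i))"
      by (auto simp: unimodular_sums_def)
    have "norm (g u) \<le> (\<Sum>i\<in>S. norm (c i * g (x i)))"
      unfolding ueq g.sum g.scale by (rule norm_sum)
    also have "\<dots> = (\<Sum>i\<in>S. norm (g (x i)))" by (simp add: norm_mult c)
    also have "\<dots> \<le> M * K" using M[OF g K S] .
    finally show ?thesis .
  qed
  have "(\<Sum>i<n. norm (q (x i))) \<le> C * M ^ Suc m" for n
  proof -
    (* c l rotates q (x l) onto its absolute value *)
    define c where "c l = (if q (x l) = 0 then 1 else of_real (norm (q (x l))) / q (x l))" for l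
    have nc: "norm (c l) = 1" for l
      by (simp add: c_def norm_divide)
    have cq: "c l * q (x l) = of_real (norm (q (x l)))" for l
      by (simp add: c_def)
    from diagonal_sum_le_multilinear[OF E banach_space_over_mult B, of "{..<n}" m c x undefined] nc
    obtain w where w: "\<And>i. i \<le> m \<Longrightarrow> w i \<in> unimodular_sums smulE x {..<n}"
      and le: "norm (\<Sum>l<n. c l * q (x l)) \<le> norm (B w)"
      unfolding qB[of _ undefined] less_Suc_eq_le by auto
    have "(\<Sum>i<n. norm (q (x i))) = norm (\<Sum>l<n. c l * q (x l))"
      by (simp add: cq sum_nonneg flip: of_real_sum)
    also have "\<dots> \<le> norm (B w)" by (rule le)
    also have "\<dots> \<le> C * M ^ Suc m"
    proof (rule multilinear_form_bounded_on_weakly_bounded_set[OF B \<open>C \<ge> 0\<close> _ \<open>M \<ge> 0\<close>])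
      show "norm (B v) \<le> C * (\<Prod>i<Suc m. norm (v i))" for v by (rule C)
      show "w i \<in> unimodular_sums smulE x {..<n}" if "i < Suc m" for i
        using w that by simp
    qed (use M' in blast)
    finally show ?thesis .
  qed
  thus ?thesis by (intro summableI_nonneg_bounded) auto
qed

section \<open>Reduction of polynomials to homogeneous ones\<close>

lemma continuous_homogeneous_polynomial_dual_comp:
  fixes smulE :: "'k::{real_normed_field, banach} \<Rightarrow> 'a::banach \<Rightarrow> 'a"
    and smulF :: "'k \<Rightarrow> 'b::banach \<Rightarrow> 'b"
  assumes Q: "continuous_homogeneous_polynomial smulE smulF k Q" and f: "f \<in> dual_space smulF"
  shows "continuous_homogeneous_polynomial smulE (*) k (\<lambda>x. f (Q x))"
proof -
  from Q obtain A where A: "continuous_symmetric_multilinear smulE smulF k A"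
    and QA: "\<And>x. Q x = A (\<lambda>i\<in>{..<k}. x)"
    by (auto simp: continuous_homogeneous_polynomial_def)
  have lin: "Vector_Spaces.linear smulF (*) f" and cont: "continuous_map euclidean euclidean f"
    using f by (auto simp: dual_space_def)
  have "continuous_symmetric_multilinear smulE (*) k (f \<circ> A)"
    unfolding continuous_symmetric_multilinear_def
  proof (intro conjI ballI allI impI)
    fix v :: "nat \<Rightarrow> 'a" and i assume "v \<in> {..<k} \<rightarrow>\<^sub>E UNIV" "i < k"
    hence "Vector_Spaces.linear smulE smulF (\<lambda>u. A (v(i := u)))"
      using A by (simp add: continuous_symmetric_multilinear_def)
    thus "Vector_Spaces.linear smulE (*) (\<lambda>u. (f \<circ> A) (v(i := u)))"
      using lin by (simp add: Vector_Spaces.linear_iff)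
  next
    show "continuous_map (product_topology (\<lambda>_. euclidean) {..<k}) euclidean (f \<circ> A)"
      using A cont by (auto simp: continuous_symmetric_multilinear_def intro: continuous_map_compose)
  qed (use A in \<open>simp add: continuous_symmetric_multilinear_def\<close>)
  thus ?thesis
    unfolding continuous_homogeneous_polynomial_def using QA by (intro exI[of _ "f \<circ> A"]) simp
qed

lemma homogeneous_polynomial_zero:
  assumes E: "banach_space_over smulE" and F: "banach_space_over smulF"
    and Q: "continuous_homogeneous_polynomial smulE smulF (Suc m) Q"
  shows "Q 0 = 0"
proof -
  from homogeneous_polynomial_form[OF E F Q] obtain B C where
    C: "\<And>v. norm (B v) \<le> C * (\<Prod>i<Suc m. norm (v i))"
    and QB: "\<And>x v. Q x = B (\<lambda>i. if i < Suc m then x else v i)"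
    by metis
  show ?thesis using C[of "\<lambda>_. 0"] QB[of 0 "\<lambda>_. 0"] by simp
qed

lemma continuous_polynomial_positive_degrees:
  fixes smulE :: "'k::{real_normed_field, banach} \<Rightarrow> 'a::banach \<Rightarrow> 'a"
    and smulF :: "'k \<Rightarrow> 'b::banach \<Rightarrow> 'b"
  assumes E: "banach_space_over smulE" and F: "banach_space_over smulF"
    and P: "continuous_polynomial smulE smulF P" and "P 0 = 0"
  obtains n Q where "\<And>k. k < n \<Longrightarrow> continuous_homogeneous_polynomial smulE smulF (Suc k) (Q k)"
    and "\<And>x. P x = (\<Sum>k<n. Q k x)"
proof -
  from P obtain n Q where
    Q: "\<And>k. k \<le> n \<Longrightarrow> continuous_homogeneous_polynomial smulE smulF k (Q k)"
    and PQ: "\<And>x. P x = (\<Sum>k\<le>n. Q k x)"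
    by (auto simp: continuous_polynomial_def)
  have PQ': "P x = Q 0 x + (\<Sum>k<n. Q (Suc k) x)" for x
    unfolding PQ by (rule sum.atMost_shift)
  have "Q (Suc k) 0 = 0" if "k < n" for k
    using homogeneous_polynomial_zero[OF E F Q, of k] that by simp
  hence "Q 0 0 = 0" using PQ'[of 0] \<open>P 0 = 0\<close> by simp
  moreover have "Q 0 x = Q 0 0" for x
    using Q[of 0] by (auto simp: continuous_homogeneous_polynomial_def restrict_def)
  ultimately have "P x = (\<Sum>k<n. Q (Suc k) x)" for x
    using PQ'[of x] by simp
  with Q show ?thesis by (intro that[of n "\<lambda>k. Q (Suc k)"]) auto
qed

theorem theorem2:
  fixes smulE :: "'k::{real_normed_field, banach} \<Rightarrow> 'a::banach \<Rightarrow> 'a"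
    and smulF :: "'k \<Rightarrow> 'b::banach \<Rightarrow> 'b"
    and P :: "'a \<Rightarrow> 'b"
  assumes "banach_space_over smulE"
    and "banach_space_over smulF"
    and "continuous_polynomial smulE smulF P"
    and "P 0 = 0"
  shows "(\<forall>x. weakly_unconditionally_Cauchy smulE x \<longrightarrow>
              weakly_unconditionally_Cauchy smulF (\<lambda>i. P (x i))) \<and>
         (\<forall>x. unconditionally_converging x \<longrightarrow>
              unconditionally_converging (\<lambda>i. P (x i)))"
proof -
  from continuous_polynomial_positive_degrees[OF assms] obtain n Q where
    Q: "\<And>k. k < n \<Longrightarrow> continuous_homogeneous_polynomial smulE smulF (Suc k) (Q k)"
    and PQ: "\<And>x. P x = (\<Sum>k<n. Q k x)"
    by blast
  show ?thesis
  proof (intro conjI allI impI)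
    fix x assume x: "weakly_unconditionally_Cauchy smulE x"
    show "weakly_unconditionally_Cauchy smulF (\<lambda>i. P (x i))"
      unfolding weakly_unconditionally_Cauchy_def
    proof
      fix f assume f: "f \<in> dual_space smulF"
      interpret f: Vector_Spaces.linear smulF "(*)" f
        using f by (simp add: dual_space_def)
      have "summable (\<lambda>i. \<Sum>k<n. norm (f (Q k (x i))))"
        using homogeneous_scalar_polynomial_absolutely_summable[OF assms(1)
            continuous_homogeneous_polynomial_dual_comp[OF Q f] x]
        by (intro summable_sum) simp
      thus "summable (\<lambda>i. norm (f (P (x i))))"
        by (rule summable_comparison_test'[of _ 0]) (simp add: PQ f.sum norm_sum)
    qed
  next
    fix x :: "nat \<Rightarrow> 'a" assume x: "unconditionally_converging x"
    have "unconditionally_converging (\<lambda>i. Q k (x i))" if "k < n" for k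
      by (rule homogeneous_polynomial_unconditionally_converging[OF assms(1,2) Q[OF that] x])
    thus "unconditionally_converging (\<lambda>i. P (x i))"
      unfolding unconditionally_converging_def PQ by (auto intro: summable_sum)
  qed
qed

end
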